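(* Let $\Delta=K_0\supseteq K_1\supseteq K_2\supseteq\cdots$ be any descending chain of simplexes. Then the intersection $K=\bigcap_{t} K_t$ is a simplex. If, in addition, each $K_t$ is unimodular and the chain is strictly decreasing infinitely often (that is, $K_{t+1}\neq K_t$ for infinitely many $t$), then $K$ has dimension strictly less than $n$.
   Context: Let $n\ge1$ and let $\Delta=\{x\in\mathbb{R}_{\ge0}^{n+1}:\sum x_i=1\}$ be the standard $n$-dimensional simplex. A simplex is the convex hull of a nonempty finite affinely independent set of points (of any dimension $\geq 0$). Let $\Sigma$ be the monoid of all matrices in $\mathrm{GL}_{n+1}(\mathbb{Z})$ with nonnegative entries; each $A\in\Sigma$ determines a continuous map $\Delta\to\Delta$ by $A(x)=Ax/\|Ax\|_1$. A unimodular simplex is a set of the form $A[\Delta]$ with $A\in\Sigma$. *)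

theory Defs
  imports "HOL-Analysis.Analysis"
begin

text \<open>
  A vector of length \<open>n + 1\<close> is an element of \<open>real ^ 'n\<close> with \<open>CARD('n) = n + 1\<close>.
\<close>

definition std_simplex :: "(real ^ 'n) set" where
  "std_simplex = {x. (\<forall>i. 0 \<le> x $ i) \<and> (\<Sum>i\<in>UNIV. x $ i) = 1}"

text \<open>
  The library relation \<open>d simplex S\<close> also admits \<open>d = -1\<close>, which holds exactly for the
  empty set; letting \<open>d\<close> range over the naturals excludes it.
\<close>

definition is_simplex :: "'a::euclidean_space set \<Rightarrow> bool" where
  "is_simplex S \<longleftrightarrow> (\<exists>d::nat. int d simplex S)"

lemma is_simplex_iff:
  "is_simplex S \<longleftrightarrow> (\<exists>C. finite C \<and> C \<noteq> {} \<and> \<not> affine_dependent C \<and> S = convex hull C)"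
proof
  assume "is_simplex S"
  then obtain d :: nat and C where "finite C" "\<not> affine_dependent C" "int (card C) = int d + 1"
      "S = convex hull C"
    unfolding is_simplex_def simplex by blast
  moreover from this have "C \<noteq> {}" by auto
  ultimately show "\<exists>C. finite C \<and> C \<noteq> {} \<and> \<not> affine_dependent C \<and> S = convex hull C"
    by blast
next
  assume "\<exists>C. finite C \<and> C \<noteq> {} \<and> \<not> affine_dependent C \<and> S = convex hull C"
  then obtain C where C: "finite C" "C \<noteq> {}" "\<not> affine_dependent C" "S = convex hull C"
    by blast
  then have "int (card C) = int (card C - 1) + 1"
    by (simp add: card_gt_0_iff of_nat_diff Suc_leI)
  with C show "is_simplex S"
    unfolding is_simplex_def simplex by blast
qed

text \<open>
  The monoid \<open>\<Sigma>\<close>; \<open>invertible\<close> is taken over the integers, so it means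
  membership in \<open>GL\<close> over the integers.
\<close>

definition nonneg_GL_int :: "(int ^ 'n ^ 'n) set" where
  "nonneg_GL_int = {A. invertible A \<and> (\<forall>i j. 0 \<le> A $ i $ j)}"

definition norm_1 :: "real ^ 'n \<Rightarrow> real" where
  "norm_1 x = (\<Sum>i\<in>UNIV. \<bar>x $ i\<bar>)"

definition proj_action :: "int ^ 'n ^ 'n \<Rightarrow> real ^ 'n \<Rightarrow> real ^ 'n" where
  "proj_action A x = (map_matrix real_of_int A *v x) /\<^sub>R norm_1 (map_matrix real_of_int A *v x)"

definition unimodular_simplex :: "(real ^ 'n) set \<Rightarrow> bool" where
  "unimodular_simplex S \<longleftrightarrow> (\<exists>A\<in>nonneg_GL_int. S = proj_action A ` std_simplex)"

end

theory Submission
  imports Defs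
begin

text \<open>Write K for the intersection. It is compact, convex and nonempty, hence the convex hull
  of its extreme points (Minkowski), and the first claim reduces to their affine independence
  (\<open>extreme_points_Inter_simplexes_aff_independent\<close>). Dimensions in the chain are
  eventually constant, so almost all simplexes have the same number m of vertices. Along a
  subsequence the i-th vertex converges to a point V i, and the i-th barycentric coordinate of an
  extreme point x to a number L (x, i). The points V i may coincide or be dependent, but x is a
  convex combination of them, so extremality gives V i = x whenever L (x, i) is nonzero. An affine
  relation c among extreme points gives, by affine independence of the vertices at each stage, a
  linear relation among their i-th coordinates; this survives in the limit, and summing it over the
  indices with V i = p leaves c p = 0.

  For the dimension bound, suppose that K has dimension n. Then K spans the hyperplane of coordinate
  sum 1 and has a positive multiple of an integer vector w in its relative interior
  (\<open>rel_interior_integer_direction\<close>). If A[\<Delta>] contains K, then w has positive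
  integer coordinates in the basis of columns of A, so every column is at most w entrywise
  (\<open>nonneg_GL_int_entry_le\<close>). Only finitely many A satisfy this, whereas infinitely
  many strict inclusions would give infinitely many unimodular simplexes containing K.\<close>

section \<open>Intersections of descending chains of simplexes\<close>

lemma common_convergent_subsequence:
  fixes s :: "'i \<Rightarrow> nat \<Rightarrow> 'a::heine_borel"
  assumes "finite I" and "\<And>i. i \<in> I \<Longrightarrow> bounded (range (s i))"
  shows "\<exists>(l :: 'i \<Rightarrow> 'a) (r :: nat \<Rightarrow> nat). strict_mono r \<and> (\<forall>i\<in>I. (s i \<circ> r) \<longlonglongrightarrow> l i)"
  using assms
proof (induction I rule: finite_induct)
  case empty
  show ?case using strict_mono_id by blast
next
  case (insert a I)
  then obtain l r where r: "strict_mono r" "\<And>i. i \<in> I \<Longrightarrow> (s i \<circ> r) \<longlonglongrightarrow> l i"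
    by (metis insertCI)
  have "bounded (range (s a \<circ> r))"
    by (rule bounded_subset[OF insert.prems[of a]]) auto
  then obtain m q where q: "strict_mono q" "(s a \<circ> r \<circ> q) \<longlonglongrightarrow> m"
    using bounded_imp_convergent_subsequence by blast
  have "(s i \<circ> (r \<circ> q)) \<longlonglongrightarrow> (l(a := m)) i" if "i \<in> insert a I" for i
  proof (cases "i = a")
    case False
    then have "i \<in> I" using that by simp
    from LIMSEQ_subseq_LIMSEQ[OF r(2)[OF this] q(1)] show ?thesis using False by (simp add: o_assoc)
  qed (use q in \<open>simp add: o_assoc\<close>)
  then show ?case using strict_mono_o[OF r(1) q(1)] by blast
qed

text \<open>Isolating the term j writes x as a convex combination of \<open>v j\<close> and the
  renormalised rest, which lies in K; extremality forbids a proper segment. The family is indexed so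
  that points may repeat, as limits of vertices can.\<close>

lemma extreme_point_of_sum:
  fixes x :: "'a::euclidean_space"
  assumes "x extreme_point_of K" "convex K" "finite I"
    and "\<And>i. i \<in> I \<Longrightarrow> v i \<in> K" "\<And>i. i \<in> I \<Longrightarrow> (u i::real) \<ge> 0" "sum u I = 1"
    and "(\<Sum>i\<in>I. u i *\<^sub>R v i) = x" and "j \<in> I" "u j \<noteq> 0"
  shows "v j = x"
proof -
  have pos: "u j > 0" using assms(5)[OF assms(8)] assms(9) by linarith
  have split: "sum u I = u j + sum u (I - {j})"
    "(\<Sum>i\<in>I. u i *\<^sub>R v i) = u j *\<^sub>R v j + (\<Sum>i\<in>I-{j}. u i *\<^sub>R v i)"
    by (simp_all add: sum.remove[OF assms(3,8)])
  define s where "s = sum u (I - {j})"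
  have s: "s \<ge> 0" "u j = 1 - s"
    using assms(5,6) split unfolding s_def by (auto intro!: sum_nonneg)
  show ?thesis
  proof (cases "s = 0")
    case True
    then have "\<forall>i\<in>I-{j}. u i = 0"
      using assms(3,5) unfolding s_def by (subst (asm) sum_nonneg_eq_0_iff) auto
    then have "(\<Sum>i\<in>I-{j}. u i *\<^sub>R v i) = 0" by (intro sum.neutral) simp
    then show ?thesis using split(2) assms(7) s True by simp
  next
    case False
    define y where "y = (\<Sum>i\<in>I-{j}. (u i / s) *\<^sub>R v i)"
    have "y \<in> K" unfolding y_def
    proof (rule convex_sum)
      show "(\<Sum>i\<in>I - {j}. u i / s) = 1"
        using False by (simp add: s_def flip: sum_divide_distrib)
    qed (use assms(2-5) s in auto)
    have "s *\<^sub>R y = (\<Sum>i\<in>I-{j}. u i *\<^sub>R v i)"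
      using False by (simp add: y_def scaleR_sum_right)
    then have x: "x = (1 - s) *\<^sub>R v j + s *\<^sub>R y"
      using split(2) assms(7) s by simp
    have "0 < s" "s < 1" using False s pos by auto
    have "v j = y"
    proof (rule ccontr)
      assume "v j \<noteq> y"
      then have "x \<in> open_segment (v j) y"
        using x \<open>0 < s\<close> \<open>s < 1\<close> by (auto simp: in_segment)
      then show False
        using assms(1,4,8) \<open>y \<in> K\<close> by (auto simp: extreme_point_of_def)
    qed
    then show ?thesis using x by (simp add: algebra_simps)
  qed
qed

lemma aff_independent_sum_zero:
  fixes C :: "'a::real_vector set"
  assumes "\<not> affine_dependent C" "finite I" "bij_betw v I C"
    and "sum u I = 0" "(\<Sum>i\<in>I. u i *\<^sub>R v i) = 0" "i \<in> I"
  shows "u i = 0"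
proof -
  define g where "g = inv_into I v"
  have fin: "finite C" using assms bij_betw_finite by blast
  have gv: "g (v i) = i" if "i \<in> I" for i
    using that assms(3) unfolding g_def by (simp add: bij_betw_def)
  have "sum (\<lambda>c. u (g c)) C = sum u I" "(\<Sum>c\<in>C. u (g c) *\<^sub>R c) = (\<Sum>i\<in>I. u i *\<^sub>R v i)"
    by (subst sum.reindex_bij_betw[OF assms(3), symmetric], simp add: gv)+
  then have "\<forall>c\<in>C. u (g c) = 0"
    using assms(1,4,5) affine_dependent_explicit_finite[OF fin] by fastforce
  moreover have "v i \<in> C" using assms(3,6) by (auto simp: bij_betw_def)
  ultimately show ?thesis using gv[OF assms(6)] by force
qed

lemma is_simplex_compact: "is_simplex S \<Longrightarrow> compact S"
  and is_simplex_convex: "is_simplex S \<Longrightarrow> convex S"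
  and is_simplex_nonempty: "is_simplex S \<Longrightarrow> S \<noteq> {}"
  by (auto simp: is_simplex_iff finite_imp_compact_convex_hull)

text \<open>
  Pass to a subsequence along which all vertices and coordinates converge. Then the limit of the barycentric coordinates of an extreme point
  \<open>x\<close> of the intersection is carried by those indices \<open>i\<close> whose vertices \<open>v t i\<close> converge to \<open>x\<close>.
  Hence the limiting coordinates separate the extreme points.
\<close>

lemma extreme_points_Inter_simplexes_aff_independent:
  fixes K :: "nat \<Rightarrow> 'a::euclidean_space set" and v :: "nat \<Rightarrow> nat \<Rightarrow> 'a"
  assumes dec: "decseq K"
    and hull: "\<And>t. K t = convex hull (v t ` {..<m})"
    and indep: "\<And>t. \<not> affine_dependent (v t ` {..<m})"
    and inj: "\<And>t. inj_on (v t) {..<m}"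
  shows "\<not> affine_dependent {x. x extreme_point_of (\<Inter>t. K t)}"
proof
  let ?K = "\<Inter>t. K t"
  have comp: "compact (K t)" for t
    by (simp add: hull finite_imp_compact_convex_hull)
  have convK: "convex ?K" by (intro convex_INT) (simp add: hull)
  assume "affine_dependent {x. x extreme_point_of ?K}"
  then obtain S c p where S: "finite S" "S \<subseteq> {x. x extreme_point_of ?K}"
    and c: "sum c S = 0" "(\<Sum>x\<in>S. c x *\<^sub>R x) = 0" and p: "p \<in> S" "c p \<noteq> 0"
    by (auto simp: affine_dependent_explicit)
  have SK: "x \<in> K t" if "x \<in> S" for x t
    using that S(2) by (auto simp: extreme_point_of_def)
  \<comment> \<open>Barycentric coordinates of x at stage t, carried by indices instead of vertices
    so that each can be followed as t varies.\<close>
  have "\<exists>u. (\<forall>i<m. 0 \<le> u i) \<and> sum u {..<m} = 1 \<and> (\<Sum>i<m. u i *\<^sub>R v t i) = x"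
    if xS: "x \<in> S" for x t
  proof -
    obtain u where u: "\<forall>y\<in>v t ` {..<m}. 0 \<le> u y" "sum u (v t ` {..<m}) = 1"
      "(\<Sum>y\<in>v t ` {..<m}. u y *\<^sub>R y) = x"
      using SK[OF xS, of t] by (auto simp: hull convex_hull_finite)
    then show ?thesis
      by (intro exI[of _ "u \<circ> v t"]) (auto simp: sum.reindex[OF inj])
  qed
  then obtain u where u: "\<And>x t i. x \<in> S \<Longrightarrow> i < m \<Longrightarrow> 0 \<le> u x t i"
    "\<And>x t. x \<in> S \<Longrightarrow> sum (u x t) {..<m} = 1"
    "\<And>x t. x \<in> S \<Longrightarrow> (\<Sum>i<m. u x t i *\<^sub>R v t i) = x"
    by metis
  have vK: "v t i \<in> K t" if "i < m" for t i
    using that by (auto simp: hull intro: hull_inc)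
  have "bounded (range (\<lambda>t. v t i))" if "i \<in> {..<m}" for i
    by (rule bounded_subset[OF compact_imp_bounded[OF comp[of 0]]])
      (use that vK decseqD[OF dec, of 0] in force)
  then obtain V r where r: "strict_mono r" "\<forall>i\<in>{..<m}. ((\<lambda>t. v t i) \<circ> r) \<longlonglongrightarrow> V i"
    using common_convergent_subsequence[of "{..<m}" "\<lambda>i t. v t i"] by auto
  have u1: "u x t i \<le> 1" if "x \<in> S" "i < m" for x t i
    using that u(1,2) member_le_sum[of i "{..<m}" "u x t"] by fastforce
  have "bounded (range (\<lambda>t. u x (r t) i))" if "(x, i) \<in> S \<times> {..<m}" for x i
    using that u(1) u1 by (intro boundedI[of _ 1]) auto
  then obtain L q where q: "strict_mono q"
    "\<forall>z\<in>S \<times> {..<m}. ((\<lambda>t. u (fst z) (r t) (snd z)) \<circ> q) \<longlonglongrightarrow> L z"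
    using common_convergent_subsequence[of "S \<times> {..<m}" "\<lambda>z t. u (fst z) (r t) (snd z)"] S(1)
    by fastforce
  let ?f = "\<lambda>t. r (q t)"
  have f: "strict_mono ?f" using strict_mono_o[OF r(1) q(1)] by (simp add: o_def)
  have Vlim: "(\<lambda>t. v (?f t) i) \<longlonglongrightarrow> V i" if "i < m" for i
    using LIMSEQ_subseq_LIMSEQ[of "(\<lambda>t. v t i) \<circ> r" "V i" q] r q that by (simp add: o_def)
  have Llim: "(\<lambda>t. u x (?f t) i) \<longlonglongrightarrow> L (x, i)" if "x \<in> S" "i < m" for x i
    using q that by (force simp: o_def)
  \<comment> \<open>Vertices of late simplexes lie in every earlier one, and \<open>K t\<close> is
    closed.\<close>
  have VK: "V i \<in> ?K" if "i < m" for i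
  proof
    fix t
    show "V i \<in> K t"
    proof (rule Lim_in_closed_set[OF compact_imp_closed[OF comp] _ _ Vlim[OF that]])
      show "\<forall>\<^sub>F s in sequentially. v (?f s) i \<in> K t"
        using eventually_ge_at_top[of t]
      proof eventually_elim
        case (elim s)
        then have "t \<le> ?f s" using strict_mono_imp_increasing[OF f, of s] by simp
        then show ?case using vK[OF that] decseqD[OF dec] by blast
      qed
    qed simp
  qed
  have Lsum: "(\<Sum>i<m. L (x, i)) = 1" if "x \<in> S" for x
  proof -
    have "(\<lambda>t. \<Sum>i<m. u x (?f t) i) \<longlonglongrightarrow> (\<Sum>i<m. L (x, i))"
      using that by (intro tendsto_sum Llim) auto
    then show ?thesis using u(2)[OF that] by (simp add: LIMSEQ_const_iff)
  qed
  have supp: "V i = x" if "x \<in> S" "i < m" "L (x, i) \<noteq> 0" for x i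
  proof (rule extreme_point_of_sum[where K = ?K and I = "{..<m}" and u = "\<lambda>i. L (x, i)"])
    show "0 \<le> L (x, j)" if "j \<in> {..<m}" for j
      using that \<open>x \<in> S\<close> u(1) by (intro LIMSEQ_le_const[OF Llim]) auto
    show "(\<Sum>i<m. L (x, i)) = 1"
      using \<open>x \<in> S\<close> by (rule Lsum)
    have "(\<lambda>t. \<Sum>i<m. u x (?f t) i *\<^sub>R v (?f t) i) \<longlonglongrightarrow> (\<Sum>i<m. L (x, i) *\<^sub>R V i)"
      using that by (intro tendsto_sum tendsto_scaleR Llim Vlim) auto
    then show "(\<Sum>i<m. L (x, i) *\<^sub>R V i) = x"
      using u(3)[OF \<open>x \<in> S\<close>] by (simp add: LIMSEQ_const_iff)
  qed (use that S(2) convK VK in auto)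
  \<comment> \<open>Independence is used at stage t, before the limit: the combined coordinates sum
    to 0 and represent the zero vector, because c is an affine relation.\<close>
  have zero: "(\<Sum>x\<in>S. c x * u x t i) = 0" if "i < m" for t i
  proof (rule aff_independent_sum_zero[OF indep[of t], where I = "{..<m}" and v = "v t"])
    show "(\<Sum>i<m. \<Sum>x\<in>S. c x * u x t i) = 0"
      by (subst sum.swap) (simp add: u(2) c(1) flip: sum_distrib_left)
    have "(\<Sum>i<m. (\<Sum>x\<in>S. c x * u x t i) *\<^sub>R v t i)
        = (\<Sum>x\<in>S. c x *\<^sub>R (\<Sum>i<m. u x t i *\<^sub>R v t i))"
      by (simp add: scaleR_sum_left scaleR_sum_right) (rule sum.swap)
    also have "\<dots> = 0" using c(2) u(3) by simp
    finally show "(\<Sum>i<m. (\<Sum>x\<in>S. c x * u x t i) *\<^sub>R v t i) = 0" .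
  qed (use inj that in \<open>auto simp: bij_betw_def\<close>)
  have Lzero: "(\<Sum>x\<in>S. c x * L (x, i)) = 0" if "i < m" for i
  proof -
    have "(\<lambda>t. \<Sum>x\<in>S. c x * u x (?f t) i) \<longlonglongrightarrow> (\<Sum>x\<in>S. c x * L (x, i))"
      using that by (intro tendsto_sum tendsto_mult_left Llim)
    then show ?thesis by (simp add: zero[OF that] LIMSEQ_const_iff)
  qed
  \<comment> \<open>The limiting coordinates at these indices sum to 1 for p and to 0 for every
    other extreme point in S, by \<open>supp\<close>.\<close>
  let ?P = "{i. i < m \<and> V i = p}"
  have delta: "(\<Sum>i\<in>?P. L (x, i)) = (if x = p then 1 else 0)" if "x \<in> S" for x
  proof (cases "x = p")
    case True
    have "(\<Sum>i\<in>?P. L (x, i)) = (\<Sum>i<m. L (x, i))"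
      using supp[OF that] True by (intro sum.mono_neutral_left) auto
    then show ?thesis using True Lsum[OF that] by simp
  next
    case False
    then show ?thesis using supp[OF that] by (auto intro!: sum.neutral)
  qed
  have "0 = (\<Sum>i\<in>?P. \<Sum>x\<in>S. c x * L (x, i))"
    using Lzero by (simp add: sum.neutral)
  also have "\<dots> = (\<Sum>x\<in>S. c x * (\<Sum>i\<in>?P. L (x, i)))"
    by (subst sum.swap) (simp add: sum_distrib_left)
  also have "\<dots> = (\<Sum>x\<in>S. if x = p then c x else 0)"
    by (intro sum.cong) (auto simp: delta)
  also have "\<dots> = c p" using S(1) p(1) by simp
  finally show False using p(2) by simp
qed

lemma is_simplex_Inter:
  fixes K :: "nat \<Rightarrow> 'a::euclidean_space set"
  assumes simp: "\<And>t. is_simplex (K t)" and dec: "decseq K"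
  shows "is_simplex (\<Inter>t. K t)"
proof -
  let ?d = "\<lambda>t. nat (aff_dim (K t))"
  \<comment> \<open>Dimensions decrease along the chain, so from the index T of least dimension on
    they are constant and the vertex count is fixed.\<close>
  obtain T where T: "\<And>t. ?d T \<le> ?d t"
    using ex_has_least_nat[of "\<lambda>_. True" 0 ?d] by auto
  have pos: "aff_dim (K t) \<ge> 0" for t
    using is_simplex_nonempty[OF simp] by (metis aff_dim_negative_iff not_less)
  have dim: "aff_dim (K (T + t)) = aff_dim (K T)" for t
    using T[of "T + t"] pos[of T] pos[of "T + t"] aff_dim_subset[OF decseqD[OF dec, of T "T + t"]]
    by simp
  let ?m = "nat (aff_dim (K T) + 1)"
  have "\<exists>v. inj_on v {..<?m} \<and> \<not> affine_dependent (v ` {..<?m}) \<and> K (T + t) = convex hull (v ` {..<?m})"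
    for t
  proof -
    obtain C where C: "finite C" "\<not> affine_dependent C" "K (T + t) = convex hull C"
      using simp[of "T + t"] by (auto simp: is_simplex_iff)
    then have "card C = ?m"
      using dim[of t] aff_dim_affine_independent[OF C(2)] by (simp add: aff_dim_convex_hull)
    then obtain v where "bij_betw v {..<?m} C"
      using ex_bij_betw_nat_finite[OF C(1)] by (auto simp: atLeast0LessThan)
    then show ?thesis using C by (auto simp: bij_betw_def)
  qed
  then obtain v where v: "\<And>t. inj_on (v t) {..<?m}" "\<And>t. \<not> affine_dependent (v t ` {..<?m})"
      "\<And>t. K (T + t) = convex hull (v t ` {..<?m})"
    by metis
  have "decseq (\<lambda>t. K (T + t))"
    using dec by (simp add: decseq_def)
  from extreme_points_Inter_simplexes_aff_independent[OF this v(3,2,1)]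
  have indep: "\<not> affine_dependent {x. x extreme_point_of (\<Inter>t. K (T + t))}" .
  define E where "E = {x. x extreme_point_of (\<Inter>t. K t)}"
  have eq: "(\<Inter>t. K (T + t)) = (\<Inter>t. K t)"
  proof (rule antisym)
    show "(\<Inter>t. K (T + t)) \<subseteq> (\<Inter>t. K t)"
      using decseqD[OF dec le_add2[of _ T]] by blast
  qed auto
  have "compact (\<Inter>t. K t)"
    by (rule compact_Inter) (auto intro: is_simplex_compact simp)
  moreover have "convex (\<Inter>t. K t)"
    by (intro convex_INT is_simplex_convex simp)
  ultimately have hull: "(\<Inter>t. K t) = convex hull E"
    unfolding E_def by (rule Krein_Milman_Minkowski)
  have "(\<Inter>t. K t) \<noteq> {}"
    by (intro compact_nest is_simplex_compact is_simplex_nonempty simp decseqD[OF dec])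
  then have "E \<noteq> {}"
    using hull by auto
  moreover have "\<not> affine_dependent E"
    using indep unfolding eq E_def .
  ultimately show ?thesis
    unfolding is_simplex_iff using hull aff_independent_finite by blast
qed

section \<open>Finiteness of the unimodular simplexes containing a full-dimensional convex
  set\<close>

lemma map_matrix_of_int_mult:
  "map_matrix real_of_int (A ** B) = map_matrix real_of_int A ** map_matrix real_of_int B"
  by (simp add: vec_eq_iff matrix_matrix_mult_def map_matrix_def)

lemma map_matrix_of_int_mat_1: "map_matrix real_of_int (mat 1) = mat 1"
  by (simp add: vec_eq_iff mat_def map_matrix_def)

text \<open>Rational points approximate x0: round N x0 down, divide by N, and rescale to coordinate
  sum 1. The rescaling returns to the affine hull of K, in which the relative interior is
  open.\<close>

lemma rel_interior_integer_direction:
  fixes K :: "(real ^ 'n) set"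
  assumes "x0 \<in> rel_interior K" "affine hull K = {x. (\<Sum>i\<in>UNIV. x $ i) = 1}"
  obtains w :: "int ^ 'n" and s :: real
  where "s > 0" "(\<chi> i. of_int (w $ i) / s) \<in> rel_interior K"
proof -
  let ?y = "\<lambda>N. (\<chi> i. of_int \<lfloor>real N * x0 $ i\<rfloor> / real N) :: real ^ 'n"
  have lim: "?y \<longlonglongrightarrow> x0"
  proof (rule vec_tendstoI)
    fix i
    have "(\<lambda>N. of_int \<lfloor>real N * x0 $ i\<rfloor> / real N) \<longlonglongrightarrow> x0 $ i"
    proof (rule real_tendsto_sandwich)
      show "\<forall>\<^sub>F N in sequentially. x0 $ i - 1 / real N \<le> of_int \<lfloor>real N * x0 $ i\<rfloor> / real N"
        using eventually_gt_at_top[of 0]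
      proof eventually_elim
        case (elim N)
        have "real N * x0 $ i - 1 \<le> of_int \<lfloor>real N * x0 $ i\<rfloor>" by linarith
        from divide_right_mono[OF this, of "real N"] show ?case
          using elim by (simp add: diff_divide_distrib)
      qed
      show "\<forall>\<^sub>F N in sequentially. of_int \<lfloor>real N * x0 $ i\<rfloor> / real N \<le> x0 $ i"
        using eventually_gt_at_top[of 0]
      proof eventually_elim
        case (elim N)
        have "of_int \<lfloor>real N * x0 $ i\<rfloor> \<le> real N * x0 $ i" by linarith
        from divide_right_mono[OF this, of "real N"] show ?case using elim by simp
      qed
      show "(\<lambda>N. x0 $ i - 1 / real N) \<longlonglongrightarrow> x0 $ i"
        using tendsto_diff[OF tendsto_const lim_1_over_n, of "x0 $ i"] by simp
    qed simp
    then show "(\<lambda>N. ?y N $ i) \<longlonglongrightarrow> x0 $ i" by simp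
  qed
  have "x0 \<in> affine hull K"
    by (rule hull_inc) (use assms(1) rel_interior_subset in blast)
  then have sum0: "(\<Sum>i\<in>UNIV. x0 $ i) = 1" using assms(2) by simp
  define y where "y = ?y"
  define S where "S N = (\<Sum>i\<in>UNIV. y N $ i)" for N
  have lim: "y \<longlonglongrightarrow> x0" using lim by (simp only: y_def)
  have "S \<longlonglongrightarrow> (\<Sum>i\<in>UNIV. x0 $ i)"
    unfolding S_def by (intro tendsto_sum tendsto_vec_nth lim)
  then have limS: "S \<longlonglongrightarrow> 1" by (simp only: sum0)
  have limz: "(\<lambda>N. y N /\<^sub>R S N) \<longlonglongrightarrow> x0"
    by (rule tendsto_scaleR[OF tendsto_inverse[OF limS] lim, simplified])
  obtain T where T: "open T" "rel_interior K = affine hull K \<inter> T"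
    using openin_rel_interior[of K] by (auto simp: openin_open)
  have "\<forall>\<^sub>F N in sequentially. y N /\<^sub>R S N \<in> T"
    using topological_tendstoD[OF limz T(1)] assms(1) T(2) by auto
  moreover have "\<forall>\<^sub>F N in sequentially. S N > 0"
    using order_tendstoD(1)[OF limS, of 0] by simp
  ultimately have "\<forall>\<^sub>F N in sequentially. y N /\<^sub>R S N \<in> T \<and> S N > 0 \<and> N > 0"
    using eventually_gt_at_top[of 0] by eventually_elim simp
  then obtain N where N: "y N /\<^sub>R S N \<in> T" "S N > 0" "N > 0"
    using eventually_happens'[OF sequentially_bot] by blast
  have "(\<Sum>i\<in>UNIV. (y N /\<^sub>R S N) $ i) = inverse (S N) * S N"
    by (simp only: vector_scaleR_component real_scaleR_def S_def sum_distrib_left)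
  then have "(\<Sum>i\<in>UNIV. (y N /\<^sub>R S N) $ i) = 1"
    using N(2) by simp
  then have "y N /\<^sub>R S N \<in> rel_interior K"
    using T(2) N(1) assms(2) by simp
  moreover have "y N /\<^sub>R S N = (\<chi> i. of_int ((\<chi> i. \<lfloor>real N * x0 $ i\<rfloor>) $ i) / (S N * real N))"
    by (simp add: vec_eq_iff y_def divide_inverse mult_ac)
  ultimately show ?thesis
    using that[of "S N * real N" "\<chi> i. \<lfloor>real N * x0 $ i\<rfloor>"] N by simp
qed

text \<open>
  The coordinates of \<open>w\<close> with respect to the columns of \<open>A\<close> are integers and, as \<open>w\<close> points into the
  interior, strictly positive; so they are at least 1 and \<open>w\<close> dominates every column.
\<close>

lemma nonneg_GL_int_entry_le:
  fixes K :: "(real ^ 'n) set" and w :: "int ^ 'n"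
  assumes A: "A \<in> nonneg_GL_int" and KA: "K \<subseteq> proj_action A ` std_simplex"
    and hull: "affine hull K = {x. (\<Sum>i\<in>UNIV. x $ i) = 1}"
    and s: "s > 0" and z: "(\<chi> i. of_int (w $ i) / s) \<in> rel_interior K"
  shows "A $ i $ j \<le> w $ i"
proof -
  obtain B where B: "A ** B = mat 1" "B ** A = mat 1"
    using A by (auto simp: nonneg_GL_int_def invertible_def)
  have A0: "0 \<le> A $ i $ j" for i j using A by (simp add: nonneg_GL_int_def)
  let ?A = "map_matrix real_of_int A" and ?B = "map_matrix real_of_int B"
  let ?z = "(\<chi> i. of_int (w $ i) / s) :: real ^ 'n"
  have BA: "?B *v (?A *v x) = x" for x
    by (simp add: matrix_vector_mul_assoc B map_matrix_of_int_mat_1 flip: map_matrix_of_int_mult)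
  \<comment> \<open>B undoes A up to the nonnegative normalising factor, so points of K have
    nonnegative coordinates with respect to the columns of A.\<close>
  have nonneg: "0 \<le> (?B *v y) $ k" if yK: "y \<in> K" for y k
  proof -
    obtain x where x: "x \<in> std_simplex" and y: "y = proj_action A x"
      using yK KA by blast
    have "?B *v y = x /\<^sub>R norm_1 (?A *v x)"
      by (simp add: y proj_action_def matrix_vector_mult_scaleR BA)
    then show ?thesis
      using x by (simp add: std_simplex_def norm_1_def sum_nonneg)
  qed
  obtain e where e: "e > 0" "ball ?z e \<inter> affine hull K \<subseteq> K" and zK: "?z \<in> K"
    using z by (auto simp: mem_rel_interior_ball)
  have "?z \<in> affine hull K" using zK by (rule hull_inc)
  then have sumz: "(\<Sum>i\<in>UNIV. ?z $ i) = 1" unfolding hull by blast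
  have pos: "0 < (?B *v ?z) $ k" for k
  proof (rule ccontr)
    assume "\<not> 0 < (?B *v ?z) $ k"
    then have zero: "(?B *v ?z) $ k = 0" using nonneg[OF zK, of k] by simp
    \<comment> \<open>If coordinate k vanished at \<open>?z\<close>, a small step away from column k
      would make it negative. Subtracting a multiple of \<open>?z\<close> gives d coordinate sum 0,
      so the step stays in the affine hull, and leaves the k-th coordinate of d equal to 1. The
      summand 1 in h covers the case d = 0 uniformly.\<close>
    define a where "a = ?A *v axis k 1"
    define d where "d = a - (\<Sum>i\<in>UNIV. a $ i) *\<^sub>R ?z"
    define h where "h = e / (norm d + 1) / 2"
    have h: "h > 0" using e by (simp add: h_def add_nonneg_pos)
    have "h * norm d < e"
    proof -
      have "h * norm d \<le> h * (norm d + 1)" using h by simp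
      also have "\<dots> = e / 2"
      proof -
        have "e / c / 2 * c = e / 2" if "c > 0" for c
          using that by simp
        then show ?thesis
          unfolding h_def using norm_ge_zero[of d] by (simp only: add_nonneg_pos zero_less_one)
      qed
      finally show ?thesis using e by simp
    qed
    then have "?z - h *\<^sub>R d \<in> ball ?z e" using h by (simp add: dist_norm)
    moreover have "(\<Sum>i\<in>UNIV. d $ i) = (\<Sum>i\<in>UNIV. a $ i) - (\<Sum>i\<in>UNIV. a $ i) * (\<Sum>i\<in>UNIV. ?z $ i)"
      by (simp only: d_def vector_minus_component vector_scaleR_component real_scaleR_def
          sum_subtractf sum_distrib_left)
    then have "(\<Sum>i\<in>UNIV. d $ i) = 0"
      unfolding sumz by simp
    then have "(\<Sum>i\<in>UNIV. (?z - h *\<^sub>R d) $ i) = 1"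
      using sumz by (simp add: sum_subtractf flip: sum_distrib_left)
    ultimately have "?z - h *\<^sub>R d \<in> K" using e hull by blast
    then have "0 \<le> (?B *v (?z - h *\<^sub>R d)) $ k" by (rule nonneg)
    moreover have "(?B *v d) $ k = 1"
      using zero by (simp add: d_def a_def matrix_vector_mult_diff_distrib matrix_vector_mult_scaleR BA)
    ultimately show False
      using h zero by (simp add: matrix_vector_mult_diff_distrib matrix_vector_mult_scaleR)
  qed
  \<comment> \<open>B has integer entries, so c is an integer vector and positivity improves to at
    least 1.\<close>
  define c where "c = B *v w"
  have c1: "1 \<le> c $ k" for k
  proof -
    have "(?B *v ?z) $ k = of_int (c $ k) / s"
      by (simp add: c_def matrix_vector_mult_def map_matrix_def sum_divide_distrib)
    then have "0 < real_of_int (c $ k)" using pos[of k] s by (simp add: zero_less_divide_iff)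
    then show ?thesis by simp
  qed
  have "A *v c = w" by (simp add: c_def matrix_vector_mul_assoc B)
  then have "w $ i = (\<Sum>k\<in>UNIV. A $ i $ k * c $ k)" by (auto simp: matrix_vector_mult_def)
  moreover have "A $ i $ j * c $ j \<le> (\<Sum>k\<in>UNIV. A $ i $ k * c $ k)"
    by (intro member_le_sum mult_nonneg_nonneg A0 order_trans[OF zero_le_one c1]) auto
  moreover have "A $ i $ j * 1 \<le> A $ i $ j * c $ j"
    using A0 c1 by (intro mult_left_mono)
  ultimately show ?thesis by simp
qed

lemma finite_vec_Collect:
  fixes S :: "'n::finite \<Rightarrow> 'a set"
  assumes "\<And>i. finite (S i)"
  shows "finite {x :: 'a ^ 'n. \<forall>i. x $ i \<in> S i}"
proof (rule finite_subset)
  show "{x :: 'a ^ 'n. \<forall>i. x $ i \<in> S i} \<subseteq> vec_lambda ` Pi\<^sub>E UNIV S"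
    by (auto intro!: image_eqI[where x = "vec_nth _"] simp: vec_nth_inverse)
  show "finite (vec_lambda ` Pi\<^sub>E UNIV S)"
    using assms by (intro finite_imageI finite_PiE) auto
qed

lemma finite_nonneg_matrices_le:
  "finite {A :: int ^ 'n ^ 'm. \<forall>i j. 0 \<le> A $ i $ j \<and> A $ i $ j \<le> w $ i}"
proof -
  have "finite {x :: int ^ 'n. \<forall>j. x $ j \<in> {0..w $ i}}" for i
    by (rule finite_vec_Collect) simp
  then have "finite {A :: int ^ 'n ^ 'm. \<forall>i. A $ i \<in> {x. \<forall>j. x $ j \<in> {0..w $ i}}}"
    by (rule finite_vec_Collect)
  then show ?thesis by simp
qed

text \<open>One vector w, chosen from K alone, bounds the matrices of all these simplexes at
  once.\<close>

lemma finite_unimodular_simplexes_superset: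
  fixes K :: "(real ^ 'n) set"
  assumes "convex K" "affine hull K = {x. (\<Sum>i\<in>UNIV. x $ i) = 1}" "K \<noteq> {}"
  shows "finite {S. unimodular_simplex S \<and> K \<subseteq> S}"
proof -
  obtain x0 where "x0 \<in> rel_interior K"
    using rel_interior_eq_empty[OF assms(1)] assms(3) by blast
  from rel_interior_integer_direction[OF this assms(2)]
  obtain w :: "int ^ 'n" and s :: real
    where w: "s > 0" "(\<chi> i. of_int (w $ i) / s) \<in> rel_interior K" .
  have "{S. unimodular_simplex S \<and> K \<subseteq> S} \<subseteq> (\<lambda>A. proj_action A ` std_simplex) `
    {A. \<forall>i j. 0 \<le> A $ i $ j \<and> A $ i $ j \<le> w $ i}"
  proof clarify
    fix S :: "(real ^ 'n) set"
    assume "unimodular_simplex S" "K \<subseteq> S"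
    then obtain A where A: "A \<in> nonneg_GL_int" "S = proj_action A ` std_simplex"
      by (auto simp: unimodular_simplex_def)
    then have "A $ i $ j \<le> w $ i" for i j
      using \<open>K \<subseteq> S\<close> by (intro nonneg_GL_int_entry_le[OF A(1) _ assms(2) w]) simp
    then have "\<forall>i j. 0 \<le> A $ i $ j \<and> A $ i $ j \<le> w $ i"
      using A(1) by (simp add: nonneg_GL_int_def)
    then show "S \<in> (\<lambda>A. proj_action A ` std_simplex) `
        {A. \<forall>i j. 0 \<le> A $ i $ j \<and> A $ i $ j \<le> w $ i}"
      using A(2) by blast
  qed
  then show ?thesis
    by (rule finite_subset) (intro finite_imageI finite_nonneg_matrices_le)
qed

theorem theorem1p4:
  fixes n :: nat and K :: "nat \<Rightarrow> (real ^ 'n) set"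
  assumes "n \<ge> 1" and "CARD('n) = n + 1"
    and "K 0 = std_simplex"
    and "\<And>t. is_simplex (K t)"
    and "\<And>t. K (Suc t) \<subseteq> K t"
  shows "is_simplex (\<Inter>t. K t) \<and>
    ((\<forall>t. unimodular_simplex (K t)) \<and> infinite {t. K (Suc t) \<noteq> K t}
      \<longrightarrow> aff_dim (\<Inter>t. K t) < int n)"
proof (intro conjI impI)
  have dec: "decseq K" using assms(5) by (rule decseq_SucI)
  show simp: "is_simplex (\<Inter>t. K t)"
    using is_simplex_Inter assms(4) dec by blast
  assume "(\<forall>t. unimodular_simplex (K t)) \<and> infinite {t. K (Suc t) \<noteq> K t}"
  then have uni: "\<And>t. unimodular_simplex (K t)" and inf: "infinite {t. K (Suc t) \<noteq> K t}"
    by auto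
  show "aff_dim (\<Inter>t. K t) < int n"
  proof (rule ccontr)
    assume "\<not> aff_dim (\<Inter>t. K t) < int n"
    then have ge: "int n \<le> aff_dim (\<Inter>t. K t)" by simp
    let ?H = "{x :: real ^ 'n. (\<Sum>i\<in>UNIV. x $ i) = 1}"
    have H: "?H = {x. 1 \<bullet> x = 1}" by (simp add: inner_vec_def)
    have sub: "(\<Inter>t. K t) \<subseteq> ?H"
      using assms(3) by (auto simp: std_simplex_def)
    have "aff_dim ?H = int n"
      unfolding H using assms(2) by (subst aff_dim_hyperplane) auto
    moreover have "affine ?H" unfolding H by (rule affine_hyperplane)
    moreover have "affine hull (\<Inter>t. K t) \<subseteq> ?H"
      using sub \<open>affine ?H\<close> by (rule hull_minimal)
    moreover have ne: "(\<Inter>t. K t) \<noteq> {}" using simp by (rule is_simplex_nonempty)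
    ultimately have "affine hull (\<Inter>t. K t) = ?H"
      using ge aff_dim_subset[OF sub] by (intro affine_dim_equal) auto
    from finite_unimodular_simplexes_superset[OF is_simplex_convex[OF simp] this ne]
    have "finite (K ` {t. K (Suc t) \<noteq> K t})"
      by (rule finite_subset[rotated]) (use uni in auto)
    \<comment> \<open>After a strict drop at s, all later sets lie in \<open>K (Suc s)\<close>, so
      \<open>K s\<close> never recurs.\<close>
    moreover have "inj_on K {t. K (Suc t) \<noteq> K t}"
    proof (rule linorder_inj_onI)
      fix s t assume "s < t" "s \<in> {t. K (Suc t) \<noteq> K t}"
      then show "K s \<noteq> K t"
        using decseqD[OF dec, of "Suc s" t] assms(5)[of s] by auto
    qed auto
    ultimately show False using inf finite_imageD by blast
  qed
qed

end
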